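(* Let $U_{n,m}$ be a uni-cyclic graph (a finite simple connected graph on $n$ vertices containing exactly one cycle, which has length $m\le n$). Then the spanning simplicial complex $\Delta_s(U_{n,m})$ is shellable.
   Context: A spanning tree of a finite simple connected graph $G(V,E)$ is a subtree of $G$ containing every vertex of $G$; $s(G)$ is the collection of all edge sets of spanning trees of $G$. The spanning simplicial complex $\Delta_s(G)$ is the simplicial complex on the vertex set $E$ (the edges of $G$) whose facets are precisely the elements of $s(G)$. Shellable has its standard meaning: the facets can be ordered $F_1,\ldots,F_q$ so that for all $1\le i<j\le q$ there exist $v\in F_j\setminus F_i$ and $l<j$ with $F_j\setminus F_l=\{v\}$. *)

theory Defs
  imports Main
begin

record 'a ugraph =
  verts :: "'a set"
  edges :: "'a set set"

definition simple_graph :: "'a ugraph \<Rightarrow> bool" where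
  "simple_graph G \<longleftrightarrow> finite (verts G) \<and>
     (\<forall>e\<in>edges G. \<exists>u\<in>verts G. \<exists>v\<in>verts G. u \<noteq> v \<and> e = {u, v})"

definition subgraph :: "'a ugraph \<Rightarrow> 'a ugraph \<Rightarrow> bool" where
  "subgraph H G \<longleftrightarrow> simple_graph H \<and> verts H \<subseteq> verts G \<and> edges H \<subseteq> edges G"

definition walk :: "'a ugraph \<Rightarrow> 'a list \<Rightarrow> bool" where
  "walk G p \<longleftrightarrow> p \<noteq> [] \<and> set p \<subseteq> verts G \<and>
     (\<forall>i. Suc i < length p \<longrightarrow> {p ! i, p ! Suc i} \<in> edges G)"

definition connected_graph :: "'a ugraph \<Rightarrow> bool" where
  "connected_graph G \<longleftrightarrow> verts G \<noteq> {} \<and>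
     (\<forall>u\<in>verts G. \<forall>v\<in>verts G. \<exists>p. walk G p \<and> hd p = u \<and> last p = v)"

text \<open>
  A cycle is a graph rather than a vertex sequence, so that the rotations and the
  reversal of a sequence count as one cycle; its length is the number of its edges.
\<close>

definition cycle_graph :: "'a ugraph \<Rightarrow> bool" where
  "cycle_graph C \<longleftrightarrow> (\<exists>vs. distinct vs \<and> 3 \<le> length vs \<and> verts C = set vs \<and>
     edges C = {{vs ! i, vs ! (Suc i mod length vs)} | i. i < length vs})"

definition tree :: "'a ugraph \<Rightarrow> bool" where
  "tree T \<longleftrightarrow> simple_graph T \<and> connected_graph T \<and>
     \<not> (\<exists>C. cycle_graph C \<and> subgraph C T)"

definition spanning_tree :: "'a ugraph \<Rightarrow> 'a ugraph \<Rightarrow> bool" where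
  "spanning_tree T G \<longleftrightarrow> subgraph T G \<and> tree T \<and> verts T = verts G"

definition spanning_tree_edge_sets :: "'a ugraph \<Rightarrow> 'a set set set" where
  "spanning_tree_edge_sets G = {edges T | T. spanning_tree T G}"

definition unicyclic :: "nat \<Rightarrow> nat \<Rightarrow> 'a ugraph \<Rightarrow> bool" where
  "unicyclic n m G \<longleftrightarrow> simple_graph G \<and> connected_graph G \<and> card (verts G) = n \<and> m \<le> n \<and>
     (\<exists>!C. cycle_graph C \<and> subgraph C G) \<and>
     (\<forall>C. cycle_graph C \<and> subgraph C G \<longrightarrow> card (edges C) = m)"

text \<open>A simplicial complex is given by the set of its faces.\<close>

definition facets :: "'b set set \<Rightarrow> 'b set set" where
  "facets \<Delta> = {F \<in> \<Delta>. \<forall>F'\<in>\<Delta>. F \<subseteq> F' \<longrightarrow> F' = F}"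

definition shellable :: "'b set set \<Rightarrow> bool" where
  "shellable \<Delta> \<longleftrightarrow> (\<exists>Fs. distinct Fs \<and> set Fs = facets \<Delta> \<and>
     (\<forall>i j. i < j \<and> j < length Fs \<longrightarrow>
        (\<exists>v \<in> Fs ! j - Fs ! i. \<exists>l<j. Fs ! j - Fs ! l = {v})))"

definition spanning_complex :: "'a ugraph \<Rightarrow> 'a set set set" where
  "spanning_complex G = {F. \<exists>T \<in> spanning_tree_edge_sets G. F \<subseteq> T}"

lemma walk_imp_path:
  assumes "walk G p"
  shows "\<exists>q. walk G q \<and> distinct q \<and> hd q = hd p \<and> last q = last p"
  using assms
proof (induction p rule: length_induct)
  case (1 p)
  show ?case
  proof (cases "distinct p")
    case True
    then show ?thesis using 1 by blast
  next
    case False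
    then obtain xs ys zs y where p: "p = xs @ [y] @ ys @ [y] @ zs"
      using not_distinct_decomp by blast
    let ?q = "xs @ [y] @ zs"
    have "{?q ! i, ?q ! Suc i} \<in> edges G" if i: "Suc i < length ?q" for i
    proof (cases "i < length xs")
      case True
      then have "?q ! i = p ! i" "?q ! Suc i = p ! Suc i"
        by (auto simp: p nth_append)
      moreover have "Suc i < length p" using i by (auto simp: p)
      ultimately show ?thesis using "1.prems" unfolding walk_def by metis
    next
      case False
      then obtain k where k: "i = length xs + k"
        by (metis le_add_diff_inverse not_less)
      let ?j = "length xs + Suc (length ys) + k"
      have "Suc ?j < length p" using i by (auto simp: p k)
      then have "{p ! ?j, p ! Suc ?j} \<in> edges G"
        using "1.prems" unfolding walk_def by blast
      moreover have "p ! ?j = ?q ! i" "p ! Suc ?j = ?q ! Suc i"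
        by (auto simp: p k nth_append nth_Cons split: nat.split)
      ultimately show ?thesis by simp
    qed
    then have "walk G ?q"
      using "1.prems" unfolding walk_def p by auto
    moreover have "length ?q < length p" by (simp add: p)
    ultimately obtain q where "walk G q" "distinct q" "hd q = hd ?q" "last q = last ?q"
      using "1.IH" by blast
    moreover have "hd ?q = hd p" "last ?q = last p"
      by (auto simp: p hd_append)
    ultimately show ?thesis by auto
  qed
qed

lemma tree_edges_maximal:
  assumes T: "tree T" and T': "tree T'" and V: "verts T = verts T'"
    and sub: "edges T \<subseteq> edges T'"
  shows "edges T = edges T'"
proof (rule ccontr)
  assume "edges T \<noteq> edges T'"
  then obtain e where e: "e \<in> edges T'" "e \<notin> edges T" using sub by blast
  obtain u v where uv: "u \<in> verts T" "v \<in> verts T" "u \<noteq> v" "e = {u, v}"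
    using T' e V unfolding tree_def simple_graph_def by metis
  obtain p where p: "walk T p" "distinct p" "hd p = u" "last p = v"
    using T uv walk_imp_path unfolding tree_def connected_graph_def by metis
  have ne: "p \<noteq> []" using p unfolding walk_def by blast
  have u: "p ! 0 = u" and v: "p ! (length p - 1) = v"
    using ne p by (auto simp: hd_conv_nth last_conv_nth)
  have len: "3 \<le> length p"
  proof (rule ccontr)
    assume "\<not> 3 \<le> length p"
    then consider "length p = 1" | "length p = 2"
      using ne by (cases "length p") (auto, linarith)
    then show False
    proof cases
      case 1
      then show False using u v uv by simp
    next
      case 2
      then have "{p ! 0, p ! Suc 0} \<in> edges T" using p(1) unfolding walk_def by simp
      then show False using 2 u v uv e by simp
    qed
  qed
  let ?E = "{{p ! i, p ! (Suc i mod length p)} | i. i < length p}"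
  let ?C = "\<lparr>verts = set p, edges = ?E\<rparr>"
  have "cycle_graph ?C" using len p unfolding cycle_graph_def by auto
  moreover have "subgraph ?C T'"
    unfolding subgraph_def
  proof (intro conjI)
    show "simple_graph ?C"
      unfolding simple_graph_def
    proof (intro conjI ballI)
      show "finite (verts ?C)" by simp
      fix f assume "f \<in> edges ?C"
      then obtain i where i: "i < length p" "f = {p ! i, p ! (Suc i mod length p)}" by auto
      have m: "Suc i mod length p < length p" using ne by simp
      have "Suc i mod length p \<noteq> i" using i(1) len by (auto simp: mod_Suc)
      then have "p ! i \<noteq> p ! (Suc i mod length p)"
        using i m p(2) by (simp add: nth_eq_iff_index_eq)
      then show "\<exists>u\<in>verts ?C. \<exists>v\<in>verts ?C. u \<noteq> v \<and> f = {u, v}"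
        using i nth_mem[OF i(1)] nth_mem[OF m] by (metis ugraph.select_convs(1))
    qed
    show "verts ?C \<subseteq> verts T'" using p V unfolding walk_def by simp
    show "edges ?C \<subseteq> edges T'"
    proof
      fix f assume "f \<in> edges ?C"
      then obtain i where i: "i < length p" "f = {p ! i, p ! (Suc i mod length p)}" by auto
      show "f \<in> edges T'"
      proof (cases "Suc i < length p")
        case True
        then show ?thesis using p(1) sub i unfolding walk_def by auto
      next
        case False
        then have il: "Suc i = length p" using i by simp
        then have "p ! i = v" using v by (metis diff_Suc_1)
        then show ?thesis using il i u uv e by (simp add: insert_commute)
      qed
    qed
  qed
  ultimately show False using T' unfolding tree_def by blast
qed

lemma facets_spanning_complex: "facets (spanning_complex G) = spanning_tree_edge_sets G"
proof
  show "facets (spanning_complex G) \<subseteq> spanning_tree_edge_sets G"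
    unfolding facets_def spanning_complex_def by auto
  show "spanning_tree_edge_sets G \<subseteq> facets (spanning_complex G)"
  proof
    fix F assume F: "F \<in> spanning_tree_edge_sets G"
    have "F' = F" if "F' \<subseteq> F''" "F'' \<in> spanning_tree_edge_sets G" "F \<subseteq> F'" for F' F''
    proof -
      have "F \<subseteq> F''" using that by blast
      then have "F = F''"
        using F that(2) tree_edges_maximal
        unfolding spanning_tree_edge_sets_def spanning_tree_def by (smt (verit) mem_Collect_eq)
      then show ?thesis using that by blast
    qed
    then show "F \<in> facets (spanning_complex G)"
      using F unfolding facets_def spanning_complex_def by blast
  qed
qed

end

theory Submission
  imports Defs
begin

text \<open>
  A spanning tree misses some edge \<open>e\<close> of the unique cycle. The graph \<open>G - e\<close> is connected,
  since it contains the tree, and acyclic, since the only cycle of \<open>G\<close> uses \<open>e\<close>; by maximality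
  of trees it equals the spanning tree. Hence any two distinct facets have the form
  \<open>E - {e}\<close> and \<open>E - {f}\<close>, their difference is a single edge, and every ordering of the
  facets is a shelling.
\<close>

lemma finite_edges:
  assumes "simple_graph G"
  shows "finite (edges G)"
proof (rule finite_subset)
  show "edges G \<subseteq> Pow (verts G)"
  proof
    fix e assume "e \<in> edges G"
    then obtain u v where "u \<in> verts G" "v \<in> verts G" "e = {u, v}"
      using assms unfolding simple_graph_def by meson
    then show "e \<in> Pow (verts G)" by simp
  qed
  show "finite (Pow (verts G))"
    using assms unfolding simple_graph_def by blast
qed

lemma simple_graph_edges_subset:
  assumes "simple_graph G" "verts H = verts G" "edges H \<subseteq> edges G"
  shows "simple_graph H"
  using assms(1) subsetD[OF assms(3)] unfolding simple_graph_def assms(2) by simp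

text \<open>Every walk survives the addition of edges.\<close>

lemma connected_graph_edges_supset:
  assumes "connected_graph T" "verts H = verts T" "edges T \<subseteq> edges H"
  shows "connected_graph H"
proof -
  have "walk H p" if "walk T p" for p
    using that assms(2,3) unfolding walk_def by auto
  then show ?thesis
    using assms(1,2) unfolding connected_graph_def by fastforce
qed

lemma spanning_tree_of_unicyclic:
  assumes G: "unicyclic n m G" and T: "spanning_tree T G"
  obtains e where "e \<in> edges G" "edges T = edges G - {e}"
proof -
  obtain C where C: "cycle_graph C" "subgraph C G"
    and uniq: "\<And>D. cycle_graph D \<Longrightarrow> subgraph D G \<Longrightarrow> D = C"
    using G unfolding unicyclic_def by blast
  have "\<not> subgraph C T"
    using T C(1) unfolding spanning_tree_def tree_def by blast
  \<comment> \<open>\<open>C\<close> is simple and its vertices lie in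
    \<open>verts G = verts T\<close>, so only a missing edge can keep \<open>C\<close> from being a
    subgraph of \<open>T\<close>.\<close>
  then obtain e where e: "e \<in> edges C" "e \<notin> edges T"
    using C(2) T unfolding subgraph_def spanning_tree_def by auto
  have eG: "e \<in> edges G" using e(1) C(2) unfolding subgraph_def by blast
  \<comment> \<open>Only the edge is removed: \<open>tree_edges_maximal\<close> compares trees on
    the same vertex set.\<close>
  let ?H = "\<lparr>verts = verts G, edges = edges G - {e}\<rparr>"
  have sub: "edges T \<subseteq> edges ?H"
    using T e(2) unfolding spanning_tree_def subgraph_def by auto
  have "simple_graph ?H"
    by (rule simple_graph_edges_subset[of G]) (use G in \<open>auto simp: unicyclic_def\<close>)
  moreover have "connected_graph ?H"
    by (rule connected_graph_edges_supset[of T])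
      (use T sub in \<open>auto simp: spanning_tree_def tree_def\<close>)
  moreover have "\<not> subgraph D ?H" if D: "cycle_graph D" for D
  proof
    assume H: "subgraph D ?H"
    then have "subgraph D G" unfolding subgraph_def by auto
    \<comment> \<open>Uniqueness identifies the cycles as graphs, so \<open>e\<close> would be an
      edge of \<open>D\<close>, although \<open>?H\<close> omits it.\<close>
    then have "D = C" using uniq D by blast
    then show False using H e(1) unfolding subgraph_def by auto
  qed
  ultimately have "tree ?H" unfolding tree_def by blast
  then have "edges T = edges ?H"
    using tree_edges_maximal[of T ?H] T sub unfolding spanning_tree_def by simp
  then show thesis using that eG by simp
qed

lemma shellable_if_facets_differ_by_one:
  assumes fin: "finite (facets \<Delta>)"
    and diff: "\<And>A B. A \<in> facets \<Delta> \<Longrightarrow> B \<in> facets \<Delta> \<Longrightarrow> A \<noteq> B \<Longrightarrow> \<exists>v. A - B = {v}"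
  shows "shellable \<Delta>"
proof -
  obtain Fs where Fs: "distinct Fs" "set Fs = facets \<Delta>"
    using finite_distinct_list[OF fin] by blast
  have "\<exists>v \<in> Fs ! j - Fs ! i. \<exists>l<j. Fs ! j - Fs ! l = {v}"
    if ij: "i < j" "j < length Fs" for i j
  proof -
    have "Fs ! j \<noteq> Fs ! i" using Fs(1) ij by (simp add: nth_eq_iff_index_eq)
    moreover have "Fs ! j \<in> facets \<Delta>" "Fs ! i \<in> facets \<Delta>"
      using Fs(2) ij nth_mem[of j Fs] nth_mem[of i Fs] by auto
    ultimately obtain v where "Fs ! j - Fs ! i = {v}" using diff by blast
    \<comment> \<open>The witness for \<open>l\<close> is \<open>i\<close> itself.\<close>
    then show ?thesis using ij(1) by blast
  qed
  then show ?thesis using Fs unfolding shellable_def by blast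
qed

theorem corollary3p9:
  fixes G :: "'a ugraph" and n m :: nat
  assumes "unicyclic n m G"
  shows "shellable (spanning_complex G)"
proof (rule shellable_if_facets_differ_by_one)
  have facet: "\<exists>e \<in> edges G. F = edges G - {e}" if "F \<in> facets (spanning_complex G)" for F
    using that spanning_tree_of_unicyclic[OF assms]
    unfolding facets_spanning_complex spanning_tree_edge_sets_def by blast
  have "finite (edges G)"
    using assms finite_edges unfolding unicyclic_def by blast
  moreover have "facets (spanning_complex G) \<subseteq> Pow (edges G)"
    using facet by blast
  ultimately show "finite (facets (spanning_complex G))"
    by (meson finite_Pow_iff finite_subset)
  fix A B
  assume "A \<in> facets (spanning_complex G)" "B \<in> facets (spanning_complex G)" and ne: "A \<noteq> B"
  then obtain e f where "A = edges G - {e}" "f \<in> edges G" "B = edges G - {f}"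
    using facet by meson
  \<comment> \<open>Distinctness of the facets forces \<open>e \<noteq> f\<close>, so
    \<open>f\<close> survives in \<open>A\<close> and is the one edge that \<open>B\<close> lacks
    there.\<close>
  then have "A - B = {f}" using ne by blast
  then show "\<exists>v. A - B = {v}" by blast
qed

end
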